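(* Suppose that $A=(A_1,\dots,A_n)$ and $B=(B_1,\dots,B_n)$ are two $n$-tuples of $d\times d$ complex matrices which are irreducible and strictly contractive, $\|A\|<1$ and $\|B\|<1$. Then $A$ and $B$ are similar if and only if $\ker\Phi_A=\ker\Phi_B$.
   Context: Fix integers $n\ge2$, $d\ge1$. For an $n$-tuple $A$, $\|A\|^2=\|\sum_iA_iA_i^*\|$. $A$ is irreducible if the unital algebra generated by $A_1,\dots,A_n$ is all of $\mathfrak M_d$. $A$ and $B$ are similar if there is one invertible $T$ with $B_i=TA_iT^{-1}$ for all $i$. $\mathcal F_n$ is the unital free semigroup on letters $1,\dots,n$; $\mathcal K_n=\ell^2(\mathcal F_n)$ with orthonormal basis $\{\xi_w\}$; $L_i\xi_w=\xi_{iw}$; $\mathfrak L_n$ is the unital algebra generated by $L_1,\dots,L_n$ closed in the weak operator topology (WOT). Each $n$-tuple $A$ of $d\times d$ matrices with $\|A\|<1$ determines a unique WOT-continuous unital homomorphism $\Phi_A:\mathfrak L_n\to\mathfrak M_d$ with $\Phi_A(L_i)=A_i$; explicitly, the minimal isometric dilation of $A$ (isometries $S_i$ with pairwise orthogonal ranges on a space containing $\mathcal V=\mathbb C^d$, with $S_i^*|_{\mathcal V}=A_i^*$ and generated by $\mathcal V$) is unitarily equivalent to $(L_1^{(s)},\dots,L_n^{(s)})$ (direct sum of $s$ copies) for some $s$, and $\Phi_A(X)=P_{\mathcal V}X^{(s)}|_{\mathcal V}$. *)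

theory Defs
  imports "HOL-Analysis.Analysis"
begin

section \<open>Square-summable functions\<close>

typedef 'a ell2 = "{f :: 'a \<Rightarrow> complex. (\<lambda>w. (cmod (f w))\<^sup>2) summable_on UNIV}"
  by (rule exI[of _ "\<lambda>_. 0"]) simp

setup_lifting type_definition_ell2

lemma ell2_summable: "(\<lambda>w. (cmod (Rep_ell2 x w))\<^sup>2) summable_on UNIV"
  using Rep_ell2[of x] by simp

lemma ell2_add_closed:
  fixes f g :: "'a \<Rightarrow> complex"
  assumes f: "(\<lambda>w. (cmod (f w))\<^sup>2) summable_on UNIV"
    and g: "(\<lambda>w. (cmod (g w))\<^sup>2) summable_on UNIV"
  shows "(\<lambda>w. (cmod (f w + g w))\<^sup>2) summable_on UNIV"
proof (rule summable_on_comparison_test)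
  show "(\<lambda>w. 2 * (cmod (f w))\<^sup>2 + 2 * (cmod (g w))\<^sup>2) summable_on UNIV"
    by (intro summable_on_add summable_on_cmult_right f g)
  fix w
  have "(cmod (f w + g w))\<^sup>2 \<le> (cmod (f w) + cmod (g w))\<^sup>2"
    by (intro power_mono norm_triangle_ineq) auto
  also have "\<dots> \<le> 2 * (cmod (f w))\<^sup>2 + 2 * (cmod (g w))\<^sup>2"
    using sum_squares_bound[of "cmod (f w)" "cmod (g w)"] by (simp add: power2_sum)
  finally show "(cmod (f w + g w))\<^sup>2 \<le> 2 * (cmod (f w))\<^sup>2 + 2 * (cmod (g w))\<^sup>2" .
qed auto

lemma ell2_scale_closed:
  fixes f :: "'a \<Rightarrow> complex"
  assumes "(\<lambda>w. (cmod (f w))\<^sup>2) summable_on UNIV"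
  shows "(\<lambda>w. (cmod (c * f w))\<^sup>2) summable_on UNIV"
  using summable_on_cmult_right[OF assms, of "(cmod c)\<^sup>2"]
  by (simp add: norm_mult power_mult_distrib)

lift_definition cscale :: "complex \<Rightarrow> 'a ell2 \<Rightarrow> 'a ell2" is "\<lambda>c f w. c * f w"
  by (auto intro: ell2_scale_closed)

text \<open>The complex inner product, linear in the first argument.\<close>

definition cinner :: "'a ell2 \<Rightarrow> 'a ell2 \<Rightarrow> complex" where
  "cinner x y = (\<Sum>\<^sub>\<infinity>w. Rep_ell2 x w * cnj (Rep_ell2 y w))"

lemma cinner_summable: "(\<lambda>w. Rep_ell2 x w * cnj (Rep_ell2 y w)) summable_on UNIV"
proof (rule abs_summable_summable, rule Infinite_Sum.abs_summable_on_comparison_test')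
  show "(\<lambda>w. (cmod (Rep_ell2 x w))\<^sup>2 + (cmod (Rep_ell2 y w))\<^sup>2) summable_on UNIV"
    by (intro summable_on_add ell2_summable)
  fix w
  have "2 * (cmod (Rep_ell2 x w) * cmod (Rep_ell2 y w))
      \<le> (cmod (Rep_ell2 x w))\<^sup>2 + (cmod (Rep_ell2 y w))\<^sup>2"
    using sum_squares_bound[of "cmod (Rep_ell2 x w)" "cmod (Rep_ell2 y w)"] by simp
  moreover have "0 \<le> cmod (Rep_ell2 x w) * cmod (Rep_ell2 y w)"
    by simp
  ultimately have "cmod (Rep_ell2 x w) * cmod (Rep_ell2 y w)
      \<le> (cmod (Rep_ell2 x w))\<^sup>2 + (cmod (Rep_ell2 y w))\<^sup>2"
    by linarith
  then show "norm (Rep_ell2 x w * cnj (Rep_ell2 y w))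
      \<le> (cmod (Rep_ell2 x w))\<^sup>2 + (cmod (Rep_ell2 y w))\<^sup>2"
    by (simp add: norm_mult)
qed

lemma Re_cinner_self: "Re (cinner x x) = (\<Sum>\<^sub>\<infinity>w. (cmod (Rep_ell2 x w))\<^sup>2)"
  unfolding cinner_def infsum_Re[OF cinner_summable, symmetric]
  by (rule infsum_cong) (simp add: cmod_power2 flip: power2_eq_square)

instantiation ell2 :: (type) real_vector
begin

lift_definition zero_ell2 :: "'a ell2" is "\<lambda>_. 0"
  by simp

lift_definition plus_ell2 :: "'a ell2 \<Rightarrow> 'a ell2 \<Rightarrow> 'a ell2" is "\<lambda>f g w. f w + g w"
  by (auto intro: ell2_add_closed)

lift_definition uminus_ell2 :: "'a ell2 \<Rightarrow> 'a ell2" is "\<lambda>f w. - f w"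
  by simp

definition minus_ell2 :: "'a ell2 \<Rightarrow> 'a ell2 \<Rightarrow> 'a ell2" where
  "minus_ell2 x y = x + - y"

definition scaleR_ell2 :: "real \<Rightarrow> 'a ell2 \<Rightarrow> 'a ell2" where
  "scaleR_ell2 r x = cscale (complex_of_real r) x"

instance
proof
  fix x y z :: "'a ell2" and a b :: real
  show "x + y + z = x + (y + z)" by transfer (simp add: add.assoc)
  show "x + y = y + x" by transfer (simp add: add.commute)
  show "0 + x = x" by transfer simp
  show "- x + x = 0" by transfer simp
  show "x - y = x + - y" by (simp add: minus_ell2_def)
  show "a *\<^sub>R (x + y) = a *\<^sub>R x + a *\<^sub>R y"
    unfolding scaleR_ell2_def by transfer (simp add: algebra_simps)
  show "(a + b) *\<^sub>R x = a *\<^sub>R x + b *\<^sub>R x"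
    unfolding scaleR_ell2_def by transfer (simp add: algebra_simps)
  show "a *\<^sub>R b *\<^sub>R x = (a * b) *\<^sub>R x"
    unfolding scaleR_ell2_def by transfer (simp add: algebra_simps)
  show "1 *\<^sub>R x = x" unfolding scaleR_ell2_def by transfer simp
qed

end

instantiation ell2 :: (type) real_inner
begin

definition inner_ell2 :: "'a ell2 \<Rightarrow> 'a ell2 \<Rightarrow> real" where
  "inner_ell2 x y = Re (cinner x y)"

definition norm_ell2 :: "'a ell2 \<Rightarrow> real" where
  "norm_ell2 x = sqrt (\<Sum>\<^sub>\<infinity>w. (cmod (Rep_ell2 x w))\<^sup>2)"

definition sgn_ell2 :: "'a ell2 \<Rightarrow> 'a ell2" where
  "sgn_ell2 x = inverse (norm x) *\<^sub>R x"

definition dist_ell2 :: "'a ell2 \<Rightarrow> 'a ell2 \<Rightarrow> real" where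
  "dist_ell2 x y = norm (x - y)"

definition uniformity_ell2 :: "('a ell2 \<times> 'a ell2) filter" where
  "uniformity_ell2 = (INF e\<in>{0<..}. principal {(x, y). dist x y < e})"

definition open_ell2 :: "'a ell2 set \<Rightarrow> bool" where
  "open_ell2 U = (\<forall>x\<in>U. \<forall>\<^sub>F (x', y) in uniformity. x' = x \<longrightarrow> y \<in> U)"

instance
proof
  fix x y z :: "'a ell2" and r :: real
  show "sgn x = x /\<^sub>R norm x" by (simp add: sgn_ell2_def)
  show "dist x y = norm (x - y)" by (simp add: dist_ell2_def)
  show "(uniformity :: ('a ell2 \<times> 'a ell2) filter)
      = (INF e\<in>{0<..}. principal {(x, y). dist x y < e})"
    by (simp add: uniformity_ell2_def)
  show "open U = (\<forall>x\<in>U. \<forall>\<^sub>F (x', y) in uniformity. x' = x \<longrightarrow> y \<in> U)" for U :: "'a ell2 set"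
    by (simp add: open_ell2_def)
  show "inner x y = inner y x"
    unfolding inner_ell2_def cinner_def infsum_Re[OF cinner_summable, symmetric]
    by (rule infsum_cong) (simp add: algebra_simps)
  show "inner (x + y) z = inner x z + inner y z"
    unfolding inner_ell2_def cinner_def plus_ell2.rep_eq distrib_right
    by (simp add: infsum_add[OF cinner_summable cinner_summable])
  show "inner (r *\<^sub>R x) y = r * inner x y"
    unfolding inner_ell2_def cinner_def scaleR_ell2_def cscale.rep_eq mult.assoc
    by (simp add: infsum_cmult_right')
  show "0 \<le> inner x x"
    unfolding inner_ell2_def Re_cinner_self by (rule infsum_nonneg) simp
  show "inner x x = 0 \<longleftrightarrow> x = 0"
  proof
    assume "inner x x = 0"
    then have "(cmod (Rep_ell2 x w))\<^sup>2 = 0" for w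
      unfolding inner_ell2_def Re_cinner_self
      by (intro nonneg_infsum_le_0D[OF _ ell2_summable, of x w]) auto
    then show "x = 0" by transfer auto
  next
    assume "x = 0"
    then show "inner x x = 0"
      by (simp add: inner_ell2_def cinner_def zero_ell2.rep_eq)
  qed
  show "norm x = sqrt (inner x x)"
    by (simp add: norm_ell2_def inner_ell2_def Re_cinner_self)
qed

end


section \<open>Bounded operators and the weak operator topology\<close>

type_synonym 'a op = "'a ell2 \<Rightarrow> 'a ell2"

definition bounded_ops :: "'a op set" where
  "bounded_ops = {X. bounded_linear X \<and> (\<forall>c x. X (cscale c x) = cscale c (X x))}"

text \<open>The coarsest topology on \<^const>\<open>bounded_ops\<close> for which all the maps
  \<open>X \<mapsto> cinner (X x) y\<close> are continuous; the target carries the product topology.\<close>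

definition wot :: "'a op topology" where
  "wot = pullback_topology bounded_ops (\<lambda>X (x, y). cinner (X x) y)
     (euclidean :: ('a ell2 \<times> 'a ell2 \<Rightarrow> complex) topology)"

inductive_set op_algebra :: "'a op set \<Rightarrow> 'a op set" for G where
  op_gen: "X \<in> G \<Longrightarrow> X \<in> op_algebra G"
| op_one: "id \<in> op_algebra G"
| op_scale: "X \<in> op_algebra G \<Longrightarrow> (\<lambda>x. cscale c (X x)) \<in> op_algebra G"
| op_add: "X \<in> op_algebra G \<Longrightarrow> Y \<in> op_algebra G \<Longrightarrow> (\<lambda>x. X x + Y x) \<in> op_algebra G"
| op_mult: "X \<in> op_algebra G \<Longrightarrow> Y \<in> op_algebra G \<Longrightarrow> X \<circ> Y \<in> op_algebra G"


section \<open>The left regular representation of the free semigroup\<close>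

text \<open>Words in the free semigroup on the letters \<open>'n\<close> are lists, with the empty word as unit.
  The formula for \<open>creation\<close> extends \<open>\<xi>\<^sub>w \<mapsto> \<xi>\<^sub>i\<^sub>w\<close> to all of \<open>\<ell>\<^sup>2\<close>; see \<open>creation_ket\<close> below.\<close>

lift_definition ket :: "'a \<Rightarrow> 'a ell2" is "\<lambda>v w. if w = v then 1 else 0"
proof -
  fix v :: 'a
  have "(\<lambda>w. (cmod (if w = v then 1 else 0))\<^sup>2) summable_on {v}"
    by simp
  then show "(\<lambda>w. (cmod (if w = v then 1 else 0))\<^sup>2) summable_on UNIV"
    using summable_on_cong_neutral[of UNIV "{v}"
      "\<lambda>w. (cmod (if w = v then 1 else 0))\<^sup>2" "\<lambda>w. (cmod (if w = v then 1 else 0))\<^sup>2"]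
    by simp
qed

lemma has_sum_creation:
  fixes g :: "'n list \<Rightarrow> real"
  assumes "(g has_sum s) UNIV"
  shows "((\<lambda>w. case w of [] \<Rightarrow> 0 | j # v \<Rightarrow> if j = i then g v else 0) has_sum s) UNIV"
proof -
  let ?h = "\<lambda>w. case w of [] \<Rightarrow> 0 | j # v \<Rightarrow> if j = i then g v else 0"
  have "(?h has_sum s) (range ((#) i))"
    using assms by (subst has_sum_reindex) (auto simp: o_def inj_on_def)
  then show ?thesis
    by (rule has_sum_cong_neutral[THEN iffD1, rotated -1]) (auto split: list.splits if_splits)
qed

lift_definition creation :: "'n \<Rightarrow> 'n list ell2 \<Rightarrow> 'n list ell2" is
  "\<lambda>i f w. case w of [] \<Rightarrow> 0 | j # v \<Rightarrow> if j = i then f v else 0"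
proof -
  fix i :: 'n and f :: "'n list \<Rightarrow> complex"
  assume "(\<lambda>w. (cmod (f w))\<^sup>2) summable_on UNIV"
  then obtain s where "((\<lambda>w. (cmod (f w))\<^sup>2) has_sum s) UNIV"
    by (auto simp: summable_on_def)
  from has_sum_creation[OF this, of i]
  have "(\<lambda>w. case w of [] \<Rightarrow> 0 | j # v \<Rightarrow> if j = i then (cmod (f v))\<^sup>2 else 0) summable_on UNIV"
    by (auto simp: summable_on_def)
  also have "(\<lambda>w. case w of [] \<Rightarrow> 0 | j # v \<Rightarrow> if j = i then (cmod (f v))\<^sup>2 else 0)
      = (\<lambda>w. (cmod (case w of [] \<Rightarrow> 0 | j # v \<Rightarrow> if j = i then f v else 0))\<^sup>2)"
    by (auto simp: fun_eq_iff split: list.splits)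
  finally show "(\<lambda>w. (cmod (case w of [] \<Rightarrow> 0 | j # v \<Rightarrow> if j = i then f v else 0))\<^sup>2)
      summable_on UNIV" .
qed

lemma creation_ket: "creation i (ket w) = ket (i # w)"
  by transfer (auto simp: fun_eq_iff split: list.splits)

lemma norm_creation: "norm (creation i x) = norm x"
proof -
  have "((\<lambda>w. (cmod (Rep_ell2 x w))\<^sup>2) has_sum (\<Sum>\<^sub>\<infinity>w. (cmod (Rep_ell2 x w))\<^sup>2)) UNIV"
    by (rule has_sum_infsum[OF ell2_summable])
  from infsumI[OF has_sum_creation[OF this, of i]]
  have "(\<Sum>\<^sub>\<infinity>w. case w of [] \<Rightarrow> 0 | j # v \<Rightarrow> if j = i then (cmod (Rep_ell2 x v))\<^sup>2 else 0)
      = (\<Sum>\<^sub>\<infinity>w. (cmod (Rep_ell2 x w))\<^sup>2)" .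
  moreover have "(cmod (Rep_ell2 (creation i x) w))\<^sup>2
      = (case w of [] \<Rightarrow> 0 | j # v \<Rightarrow> if j = i then (cmod (Rep_ell2 x v))\<^sup>2 else 0)" for w
    by (simp add: creation.rep_eq split: list.split)
  ultimately show ?thesis
    unfolding norm_ell2_def by simp
qed

lemma creation_bounded_op: "creation i \<in> bounded_ops"
proof -
  have "creation i (x + y) = creation i x + creation i y" for x y
    by transfer (auto simp: fun_eq_iff split: list.splits)
  moreover have scale: "creation i (cscale c x) = cscale c (creation i x)" for c x
    by transfer (auto simp: fun_eq_iff split: list.splits)
  ultimately show ?thesis
    unfolding bounded_ops_def
    by (auto intro!: bounded_linear_intro[of _ 1] simp: scaleR_ell2_def norm_creation)
qed

definition free_semigroup_algebra :: "'n list op set" where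
  "free_semigroup_algebra = wot closure_of op_algebra (range creation)"


section \<open>Tuples of matrices\<close>

definition cadjoint :: "complex^'d^'d \<Rightarrow> complex^'d^'d" where
  "cadjoint M = (\<chi> i j. cnj (M $ j $ i))"

definition tuple_norm :: "('n::finite \<Rightarrow> complex^'d::finite^'d) \<Rightarrow> real" where
  "tuple_norm A = sqrt (onorm ((*v) (\<Sum>i\<in>UNIV. A i ** cadjoint (A i))))"

text \<open>Multiplication by the complex scalar \<open>c\<close> is multiplication by the matrix \<open>mat c\<close>.\<close>

inductive_set matrix_algebra :: "(complex^'d::finite^'d) set \<Rightarrow> (complex^'d^'d) set" for G where
  matrix_gen: "M \<in> G \<Longrightarrow> M \<in> matrix_algebra G"
| matrix_one: "mat 1 \<in> matrix_algebra G"
| matrix_scale: "M \<in> matrix_algebra G \<Longrightarrow> mat c ** M \<in> matrix_algebra G"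
| matrix_add: "M \<in> matrix_algebra G \<Longrightarrow> N \<in> matrix_algebra G \<Longrightarrow> M + N \<in> matrix_algebra G"
| matrix_mult: "M \<in> matrix_algebra G \<Longrightarrow> N \<in> matrix_algebra G \<Longrightarrow> M ** N \<in> matrix_algebra G"

definition irreducible_tuple :: "('n \<Rightarrow> complex^'d::finite^'d) \<Rightarrow> bool" where
  "irreducible_tuple A \<longleftrightarrow> matrix_algebra (range A) = UNIV"

definition similar_tuples ::
    "('n \<Rightarrow> complex^'d::finite^'d) \<Rightarrow> ('n \<Rightarrow> complex^'d^'d) \<Rightarrow> bool" where
  "similar_tuples A B \<longleftrightarrow> (\<exists>T. invertible T \<and> (\<forall>i. B i = T ** A i ** matrix_inv T))"


section \<open>The representation determined by a strict contraction\<close>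

definition unital_hom :: "('n list op \<Rightarrow> complex^'d::finite^'d) \<Rightarrow> bool" where
  "unital_hom \<Phi> \<longleftrightarrow>
     \<Phi> id = mat 1 \<and>
     (\<forall>X\<in>free_semigroup_algebra. \<forall>c. \<Phi> (\<lambda>x. cscale c (X x)) = mat c ** \<Phi> X) \<and>
     (\<forall>X\<in>free_semigroup_algebra. \<forall>Y\<in>free_semigroup_algebra.
        \<Phi> (\<lambda>x. X x + Y x) = \<Phi> X + \<Phi> Y \<and> \<Phi> (X \<circ> Y) = \<Phi> X ** \<Phi> Y)"

text \<open>For \<open>tuple_norm A < 1\<close> there is exactly one such \<open>\<Phi>\<close>; \<^const>\<open>extensional\<close> fixes its
  (irrelevant) values outside of \<^const>\<open>free_semigroup_algebra\<close>.\<close>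

definition Phi :: "('n \<Rightarrow> complex^'d::finite^'d) \<Rightarrow> 'n list op \<Rightarrow> complex^'d^'d" where
  "Phi A = (THE \<Phi>. \<Phi> \<in> extensional free_semigroup_algebra \<and>
     unital_hom \<Phi> \<and>
     continuous_map (subtopology wot free_semigroup_algebra) euclidean \<Phi> \<and>
     (\<forall>i. \<Phi> (creation i) = A i))"

definition ker_Phi :: "('n \<Rightarrow> complex^'d::finite^'d) \<Rightarrow> 'n list op set" where
  "ker_Phi A = {X \<in> free_semigroup_algebra. Phi A X = 0}"

end

theory Submission
  imports Defs
begin

text \<open>Write \<open>A\<^sub>w\<close> for the product of the \<open>A\<^sub>i\<close> along a word \<open>w\<close>. As \<open>A\<close> is a strict row
  contraction, the entries of \<open>A\<^sub>w\<close> are square summable in \<open>w\<close>, so \<open>V f = \<Sum>\<^sub>w f(w) A\<^sub>w\<close> defines a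
  map from \<open>\<ell>\<^sup>2\<close> to the matrices, and \<open>X \<mapsto> V (X \<xi>)\<close>, with \<open>\<xi>\<close> the vacuum vector, is WOT-continuous.
  The identity \<open>V (X f) = V (X \<xi>) V f\<close> holds for polynomials in the \<open>L\<^sub>i\<close> and is preserved by
  WOT limits in \<open>X\<close>; hence \<open>\<Phi>\<^sub>A X = V (X \<xi>)\<close>. By irreducibility \<open>\<Phi>\<^sub>A\<close> is onto, so if the kernels agree,
  \<open>\<Phi>\<^sub>B\<close> factors as \<open>\<psi> \<circ> \<Phi>\<^sub>A\<close> for an automorphism \<open>\<psi>\<close> of the matrix algebra, which is inner.\<close>

section \<open>Automorphisms of a matrix algebra\<close>

lemma
  assumes "invertible A"
  shows matrix_inv_right: "A ** matrix_inv A = mat 1"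
    and matrix_inv_left: "matrix_inv A ** A = mat 1"
  using someI_ex[OF assms[unfolded invertible_def]] by (simp_all add: matrix_inv_def)

lemma matrix_add_rdistrib: "(A + B) ** C = A ** C + B ** C"
  by (simp add: matrix_matrix_mult_def vec_eq_iff distrib_right sum.distrib)

lemma mat_mult_nth:
  fixes M :: "'a::semiring_1^'d::finite^'d"
  shows "(mat c ** M) $ i $ j = c * M $ i $ j"
  by (simp add: matrix_matrix_mult_def mat_def if_distrib[of "\<lambda>x. x * _"] cong: if_cong)

text \<open>The intertwiner is \<open>x \<mapsto> \<psi> (x e\<^sub>a\<^sup>*) v\<close> for a fixed index \<open>a\<close> and a vector \<open>v\<close> not killed by
  \<open>\<psi> (e\<^sub>a e\<^sub>a\<^sup>*)\<close>.\<close>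

lemma matrix_endomorphism_inner:
  fixes \<psi> :: "'a::field^'d::finite^'d \<Rightarrow> 'a^'d^'d"
  assumes add: "\<And>M N. \<psi> (M + N) = \<psi> M + \<psi> N"
    and scale: "\<And>c M. \<psi> (mat c ** M) = mat c ** \<psi> M"
    and mult: "\<And>M N. \<psi> (M ** N) = \<psi> M ** \<psi> N"
    and inj: "\<And>M. \<psi> M = 0 \<Longrightarrow> M = 0"
  shows "\<exists>T. invertible T \<and> (\<forall>M. \<psi> M = T ** M ** matrix_inv T)"
proof -
  obtain a :: 'd where True by simp
  define E where "E x = (\<chi> i k. if k = a then x $ i else 0)" for x :: "'a^'d"
  have E_add: "E (x + y) = E x + E y" for x y
    by (simp add: E_def vec_eq_iff)
  have mat_mult_vec: "mat c *v x = c *s x" for c and x :: "'a^'d"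
    by (simp add: matrix_vector_mult_def mat_def vec_eq_iff if_distrib[of "\<lambda>x. x * _"] cong: if_cong)
  have E_scale: "E (c *s x) = mat c ** E x" for c x
    by (simp add: vec_eq_iff mat_mult_nth) (simp add: E_def)
  have E_mult: "E (M *v x) = M ** E x" for M x
    by (simp add: E_def vec_eq_iff matrix_matrix_mult_def matrix_vector_mult_def)
  have "E (axis a 1) $ a $ a = 1"
    by (simp add: E_def)
  then have "\<psi> (E (axis a 1)) \<noteq> 0"
    using inj[of "E (axis a 1)"] by auto
  then obtain v where v: "\<psi> (E (axis a 1)) *v v \<noteq> 0"
    by (metis matrix_eq matrix_vector_mult_0)
  define f where "f x = \<psi> (E x) *v v" for x
  have "Vector_Spaces.linear (*s) (*s) f"
    unfolding Vector_Spaces.linear_iff f_def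
    by (simp add: vec.vector_space_axioms E_add E_scale add scale matrix_vector_mult_add_rdistrib mat_mult_vec
        flip: matrix_vector_mul_assoc)
  then have T: "matrix f *v x = f x" for x
    by (rule matrix_works)
  have f_mult: "f (M *v x) = \<psi> M *v f x" for M x
    by (simp add: f_def E_mult mult matrix_vector_mul_assoc)
  have "x = 0" if "f x = 0" for x
  proof (rule ccontr)
    \<comment> \<open>The kernel of \<open>f\<close> is invariant under all matrices by
      \<open>f_mult\<close>, and a nonzero vector can be moved to any other; so it would contain
      \<open>axis a 1\<close>, against the choice of \<open>v\<close>.\<close>
    assume "x \<noteq> 0"
    then obtain b where b: "x $ b \<noteq> 0"
      by (auto simp: vec_eq_iff)
    \<comment> \<open>The rank-one matrix e_a e_b^* divided by the b-th coordinate of x, which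
      carries x to e_a.\<close>
    define M where "M = (\<chi> i j. if j = b then axis a 1 $ i / x $ b else 0)"
    have "M *v x = axis a 1"
      using b by (simp add: M_def matrix_vector_mult_def vec_eq_iff if_distrib[of "\<lambda>x. x * _"] cong: if_cong)
    then have "f (axis a 1) = 0"
      using f_mult[of M x] that by simp
    with v show False
      by (simp add: f_def)
  qed
  then have "inj ((*v) (matrix f))"
    by (subst vec.inj_iff_eq_0) (simp_all add: T)
  then have inv: "invertible (matrix f)"
    by (simp add: invertible_left_inverse matrix_left_invertible_injective)
  have "matrix f ** M = \<psi> M ** matrix f" for M
    by (simp add: matrix_eq T f_mult flip: matrix_vector_mul_assoc)
  then have "matrix f ** M ** matrix_inv (matrix f) = \<psi> M" for M
    using matrix_inv_right[OF inv] by (simp flip: matrix_mul_assoc)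
  with inv show ?thesis
    by metis
qed

lemma continuous_on_matrix_conj:
  fixes T S :: "complex^'d::finite^'d"
  shows "continuous_on UNIV (\<lambda>M. T ** M ** S)"
  unfolding matrix_matrix_mult_def by (intro continuous_intros)


section \<open>The weak operator topology and the free semigroup algebra\<close>

lemma topspace_wot [simp]: "topspace wot = bounded_ops"
  by (auto simp: wot_def topspace_pullback_topology)

lemma continuous_map_wot_cinner:
  "continuous_map wot euclidean (\<lambda>X. cinner (X x) y)"
proof -
  have "continuous_map euclidean euclidean (\<lambda>h :: _ \<times> _ \<Rightarrow> complex. h (x, y))"
    using continuous_map_product_projection[of "(x, y)" UNIV "\<lambda>_. euclidean :: complex topology"]
    by (simp only: euclidean_product_topology UNIV_I)
  from continuous_map_pullback[OF this, of bounded_ops "\<lambda>X (x, y). cinner (X x) y"]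
  show ?thesis
    unfolding wot_def by (simp add: o_def)
qed

text \<open>The universal property of an initial topology; it reduces each WOT continuity proof
  below to rewriting a matrix coefficient.\<close>

lemma continuous_map_into_wot:
  assumes "\<And>X. X \<in> topspace U \<Longrightarrow> f X \<in> bounded_ops"
    and "\<And>x y. continuous_map U euclidean (\<lambda>X. cinner (f X x) y)"
  shows "continuous_map U wot f"
  unfolding wot_def
proof (rule continuous_map_pullback')
  show "continuous_map U euclidean ((\<lambda>X (x, y). cinner (X x) y) \<circ> f)"
    unfolding euclidean_product_topology[symmetric] continuous_map_componentwise_UNIV
    using assms(2) by (auto simp: o_def)
qed (use assms(1) in auto)

section \<open>Sesquilinearity and complex scalars\<close>

lemma cinner_add_left: "cinner (x + y) z = cinner x z + cinner y z"
  unfolding cinner_def plus_ell2.rep_eq distrib_right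
  by (rule infsum_add[OF cinner_summable cinner_summable])

lemma cinner_scale_left: "cinner (cscale c x) z = c * cinner x z"
  unfolding cinner_def cscale.rep_eq by (simp add: mult.assoc infsum_cmult_right')

lemma cinner_commute: "cinner x y = cnj (cinner y x)"
  unfolding cinner_def infsum_cnj[symmetric] by (rule infsum_cong) simp

lemma cinner_add_right: "cinner x (y + z) = cinner x y + cinner x z"
  by (metis cinner_add_left cinner_commute complex_cnj_add)

lemma cinner_scale_right: "cinner x (cscale c z) = cnj c * cinner x z"
  by (metis cinner_scale_left cinner_commute complex_cnj_mult)

lemma cinner_ket_left: "cinner (ket w) x = cnj (Rep_ell2 x w)"
proof -
  have "cinner (ket w) x = (\<Sum>\<^sub>\<infinity>v\<in>{w}. cnj (Rep_ell2 x v))"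
    unfolding cinner_def by (rule infsum_cong_neutral) (auto simp: ket.rep_eq)
  then show ?thesis by simp
qed

lemma cscale_add: "cscale c (x + y) = cscale c x + cscale c y"
  by transfer (simp add: algebra_simps)

lemma cscale_cscale: "cscale c (cscale b x) = cscale (c * b) x"
  by transfer (simp add: algebra_simps)

lemma cscale_minus_one: "cscale (- 1) x = - x"
  by transfer simp

lemma norm_cscale: "norm (cscale c x) = cmod c * norm x"
  unfolding norm_ell2_def cscale.rep_eq
  by (simp add: norm_mult power_mult_distrib infsum_cmult_right' real_sqrt_mult)

lemma bounded_linear_cscale: "bounded_linear (cscale c)"
  by (rule bounded_linear_intro[of _ "cmod c"])
    (simp_all add: cscale_add scaleR_ell2_def cscale_cscale norm_cscale mult.commute)

section \<open>Bounded operators and polynomials in the creation operators\<close>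

lemma bounded_ops_id: "id \<in> bounded_ops"
  by (simp add: bounded_ops_def bounded_linear_ident id_def)

lemma bounded_ops_scale: "X \<in> bounded_ops \<Longrightarrow> (\<lambda>x. cscale c (X x)) \<in> bounded_ops"
  by (auto simp: bounded_ops_def cscale_cscale mult.commute
      intro: bounded_linear_compose[OF bounded_linear_cscale])

lemma bounded_ops_add:
  "X \<in> bounded_ops \<Longrightarrow> Y \<in> bounded_ops \<Longrightarrow> (\<lambda>x. X x + Y x) \<in> bounded_ops"
  by (auto simp: bounded_ops_def cscale_add intro: bounded_linear_add)

lemma bounded_ops_comp: "X \<in> bounded_ops \<Longrightarrow> Y \<in> bounded_ops \<Longrightarrow> X \<circ> Y \<in> bounded_ops"
  by (auto simp: bounded_ops_def o_def intro: bounded_linear_compose)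

lemma op_algebra_bounded_ops:
  assumes "G \<subseteq> bounded_ops"
  shows "op_algebra G \<subseteq> bounded_ops"
proof
  fix X assume "X \<in> op_algebra G"
  then show "X \<in> bounded_ops"
    by induction (use assms in \<open>auto simp: bounded_ops_id[unfolded id_def] bounded_ops_scale
        bounded_ops_add bounded_ops_comp[unfolded o_def]\<close>)
qed

lemma polynomials_bounded_ops: "op_algebra (range creation) \<subseteq> bounded_ops"
  by (rule op_algebra_bounded_ops) (auto simp: creation_bounded_op)

lemma polynomials_subset: "op_algebra (range creation) \<subseteq> free_semigroup_algebra"
  unfolding free_semigroup_algebra_def by (rule closure_of_subset) (simp add: polynomials_bounded_ops)

lemma creation_in_fsa: "creation i \<in> free_semigroup_algebra"
  by (rule subsetD[OF polynomials_subset op_gen]) simp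

lemma id_in_fsa: "id \<in> free_semigroup_algebra"
  using subsetD[OF polynomials_subset op_one] by (simp add: id_def)

section \<open>Separate WOT continuity of the algebra operations\<close>

lemma continuous_map_wot_scale:
  "continuous_map (wot :: 'a op topology) wot (\<lambda>X x. cscale c (X x))"
proof (rule continuous_map_into_wot)
  have "cinner (cscale c x) y = cinner x (cscale (cnj c) y)" for x y :: "'a ell2"
    by (simp add: cinner_scale_left cinner_scale_right)
  then show "continuous_map wot euclidean (\<lambda>X. cinner (cscale c (X x)) y)" for x y :: "'a ell2"
    by (simp add: continuous_map_wot_cinner)
qed (simp add: bounded_ops_scale)

lemma continuous_map_wot_add:
  "Y \<in> bounded_ops \<Longrightarrow> continuous_map wot wot (\<lambda>X x. X x + Y x)"
  by (rule continuous_map_into_wot)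
    (auto simp: cinner_add_left bounded_ops_add intro!: continuous_map_add continuous_map_wot_cinner)

lemma continuous_map_wot_comp_right:
  "Y \<in> bounded_ops \<Longrightarrow> continuous_map wot wot (\<lambda>X. X \<circ> Y)"
  by (rule continuous_map_into_wot) (auto simp: bounded_ops_comp intro: continuous_map_wot_cinner)

text \<open>The adjoint of \<open>creation i\<close>, as \<open>cinner_creation_left\<close>
  confirms.\<close>

lift_definition annihilation :: "'n \<Rightarrow> 'n list ell2 \<Rightarrow> 'n list ell2" is "\<lambda>i f w. f (i # w)"
proof -
  fix i :: 'n and f :: "'n list \<Rightarrow> complex"
  assume "(\<lambda>w. (cmod (f w))\<^sup>2) summable_on UNIV"
  then have "(\<lambda>w. (cmod (f w))\<^sup>2) summable_on range ((#) i)"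
    by (rule summable_on_subset_banach) simp
  then show "(\<lambda>w. (cmod (f (i # w)))\<^sup>2) summable_on UNIV"
    by (subst (asm) summable_on_reindex) (auto simp: o_def)
qed

lemma cinner_creation_left: "cinner (creation i x) y = cinner x (annihilation i y)"
proof -
  have "cinner (creation i x) y
      = (\<Sum>\<^sub>\<infinity>w\<in>range ((#) i). Rep_ell2 (creation i x) w * cnj (Rep_ell2 y w))"
    unfolding cinner_def
    by (rule infsum_cong_neutral) (auto simp: creation.rep_eq split: list.splits)
  also have "\<dots> = cinner x (annihilation i y)"
    unfolding cinner_def
    by (subst infsum_reindex) (auto simp: o_def creation.rep_eq annihilation.rep_eq)
  finally show ?thesis .
qed

text \<open>The adjoint is assembled by induction from those of the generators. Moving a left factor
  to the other side of the inner product is what makes left multiplication WOT-continuous.\<close>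

lemma polynomial_has_adjoint:
  assumes "X \<in> op_algebra (range creation)"
  shows "\<exists>Y. \<forall>x y. cinner (X x) y = cinner x (Y y)"
  using assms
proof induction
  case (op_gen X)
  then show ?case by (auto simp: cinner_creation_left)
next
  case op_one
  then show ?case by (auto intro: exI[of _ id])
next
  case (op_scale X c)
  then obtain Y where "\<forall>x y. cinner (X x) y = cinner x (Y y)" by auto
  then show ?case
    by (intro exI[of _ "\<lambda>y. cscale (cnj c) (Y y)"]) (simp add: cinner_scale_left cinner_scale_right)
next
  case (op_add X X')
  then obtain Y Y' where "\<forall>x y. cinner (X x) y = cinner x (Y y)"
    "\<forall>x y. cinner (X' x) y = cinner x (Y' y)" by auto
  then show ?case
    by (intro exI[of _ "\<lambda>y. Y y + Y' y"]) (simp add: cinner_add_left cinner_add_right)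
next
  case (op_mult X X')
  then obtain Y Y' where "\<forall>x y. cinner (X x) y = cinner x (Y y)"
    "\<forall>x y. cinner (X' x) y = cinner x (Y' y)" by auto
  then show ?case
    by (intro exI[of _ "Y' \<circ> Y"]) simp
qed

lemma continuous_map_wot_comp_left:
  assumes "X \<in> op_algebra (range creation)"
  shows "continuous_map wot wot ((\<circ>) X)"
proof (rule continuous_map_into_wot)
  obtain Y where "\<And>x y. cinner (X x) y = cinner x (Y y)"
    using polynomial_has_adjoint[OF assms] by auto
  then show "continuous_map wot euclidean (\<lambda>Z. cinner ((X \<circ> Z) x) y)" for x y
    by (simp add: continuous_map_wot_cinner)
qed (use assms polynomials_bounded_ops bounded_ops_comp in auto)

text \<open>Operator multiplication is only separately WOT-continuous, so the two arguments pass to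
  the closure one after the other. The asymmetric hypotheses fit this: on the left a fixed factor
  comes from \<open>S\<close>, on the right it is arbitrary.\<close>

lemma closure_of_closed_binop:
  assumes left: "\<And>x. x \<in> S \<Longrightarrow> continuous_map U U (f x)"
    and right: "\<And>y. y \<in> topspace U \<Longrightarrow> continuous_map U U (\<lambda>x. f x y)"
    and closed: "\<And>x y. x \<in> S \<Longrightarrow> y \<in> S \<Longrightarrow> f x y \<in> S"
    and x: "x \<in> U closure_of S" and y: "y \<in> U closure_of S"
  shows "f x y \<in> U closure_of S"
proof -
  \<comment> \<open>First limit: the left argument stays in \<open>S\<close> while the right one
    runs to \<open>y\<close>.\<close>
  have "f z y \<in> U closure_of S" if "z \<in> S" for z
  proof -
    have "f z ` S \<subseteq> S"
      using closed[OF that] by blast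
    from closure_of_mono[OF this] show ?thesis
      using continuous_map_image_closure_subset[OF left[OF that], of S] y
      by (meson image_eqI subsetD)
  qed
  \<comment> \<open>Second limit: \<open>y\<close> is now fixed in the closure and the left argument
    runs to \<open>x\<close>; the values stay in the closure because it is closed.\<close>
  then have "(\<lambda>z. f z y) ` S \<subseteq> U closure_of S"
    by blast
  then have "U closure_of ((\<lambda>z. f z y) ` S) \<subseteq> U closure_of S"
    by (rule closure_of_minimal) simp
  moreover have "y \<in> topspace U"
    using y closure_of_subset_topspace by fastforce
  ultimately show ?thesis
    using continuous_map_image_closure_subset[OF right, of y S] x
    by (meson image_eqI subsetD)
qed

section \<open>The free semigroup algebra is closed under the algebra operations\<close>

lemma fsa_scale:
  fixes X :: "'n list op"
  assumes "X \<in> free_semigroup_algebra"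
  shows "(\<lambda>x. cscale c (X x)) \<in> free_semigroup_algebra"
proof -
  define f where "f = (\<lambda>(X :: 'n list op) x. cscale c (X x))"
  have "f ` op_algebra (range creation) \<subseteq> op_algebra (range creation)"
    unfolding f_def by (rule image_subsetI) (rule op_scale)
  moreover have "f X \<in> f ` (wot closure_of op_algebra (range creation))"
    using assms unfolding free_semigroup_algebra_def by (rule imageI)
  moreover have "continuous_map wot wot f"
    unfolding f_def by (rule continuous_map_wot_scale)
  ultimately have "f X \<in> wot closure_of op_algebra (range creation)"
    using continuous_map_image_closure_subset closure_of_mono by (meson subsetD)
  then show ?thesis
    by (simp add: f_def free_semigroup_algebra_def)
qed

lemma fsa_add:
  fixes X Y :: "'n list op"
  assumes X: "X \<in> free_semigroup_algebra" and Y: "Y \<in> free_semigroup_algebra"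
  shows "(\<lambda>x. X x + Y x) \<in> free_semigroup_algebra"
  unfolding free_semigroup_algebra_def
proof (rule closure_of_closed_binop[where f = "\<lambda>X Y x. X x + Y x",
      OF _ _ _ X[unfolded free_semigroup_algebra_def] Y[unfolded free_semigroup_algebra_def]])
  fix Z :: "'n list op"
  show "continuous_map wot wot (\<lambda>W x. W x + Z x)" if "Z \<in> topspace wot"
    by (rule continuous_map_wot_add) (use that in simp)
  show "continuous_map wot wot (\<lambda>W x. Z x + W x)" if "Z \<in> op_algebra (range creation)"
    using continuous_map_wot_add[OF polynomials_bounded_ops[THEN subsetD, OF that]]
    by (simp only: add.commute[of "Z _"])
  fix W :: "'n list op"
  assume "Z \<in> op_algebra (range creation)" "W \<in> op_algebra (range creation)"
  then show "(\<lambda>x. Z x + W x) \<in> op_algebra (range creation)"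
    by (rule op_add)
qed

lemma fsa_comp:
  fixes X Y :: "'n list op"
  assumes X: "X \<in> free_semigroup_algebra" and Y: "Y \<in> free_semigroup_algebra"
  shows "X \<circ> Y \<in> free_semigroup_algebra"
  unfolding free_semigroup_algebra_def
proof (rule closure_of_closed_binop[where f = "(\<circ>)",
      OF _ _ _ X[unfolded free_semigroup_algebra_def] Y[unfolded free_semigroup_algebra_def]])
  fix Z :: "'n list op"
  show "continuous_map wot wot (\<lambda>W. W \<circ> Z)" if "Z \<in> topspace wot"
    by (rule continuous_map_wot_comp_right) (use that in simp)
  show "continuous_map wot wot ((\<circ>) Z)" if "Z \<in> op_algebra (range creation)"
    by (rule continuous_map_wot_comp_left) (rule that)
  fix W :: "'n list op"
  assume "Z \<in> op_algebra (range creation)" "W \<in> op_algebra (range creation)"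
  then show "Z \<circ> W \<in> op_algebra (range creation)"
    using op_mult[of Z _ W] by (simp add: o_def)
qed

lemma fsa_diff:
  assumes "X \<in> free_semigroup_algebra" "Y \<in> free_semigroup_algebra"
  shows "(\<lambda>x. X x - Y x) \<in> free_semigroup_algebra"
  using fsa_add[OF assms(1) fsa_scale[OF assms(2), of "- 1"]] by (simp add: cscale_minus_one)


section \<open>Characterisation of \<open>Phi\<close>\<close>

text \<open>The predicate under the \<open>THE\<close> in \<open>Phi\<close>. It puts no bound on
  the tuple, so it also applies to conjugates of a strict contraction, which may have larger
  norm.\<close>

definition represents ::
    "('n \<Rightarrow> complex^'d::finite^'d) \<Rightarrow> ('n list op \<Rightarrow> complex^'d^'d) \<Rightarrow> bool" where
  "represents A \<Phi> \<longleftrightarrow> \<Phi> \<in> extensional free_semigroup_algebra \<and> unital_hom \<Phi> \<and>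
     continuous_map (subtopology wot free_semigroup_algebra) euclidean \<Phi> \<and>
     (\<forall>i. \<Phi> (creation i) = A i)"

lemma representsD:
  assumes "represents A \<Phi>"
  shows "\<Phi> \<in> extensional free_semigroup_algebra"
    and "unital_hom \<Phi>"
    and "continuous_map (subtopology wot free_semigroup_algebra) euclidean \<Phi>"
    and "\<Phi> (creation i) = A i"
  using assms by (simp_all add: represents_def)

lemma unital_homD:
  assumes "unital_hom \<Phi>"
  shows "\<Phi> id = mat 1"
    and "X \<in> free_semigroup_algebra \<Longrightarrow> \<Phi> (\<lambda>x. cscale c (X x)) = mat c ** \<Phi> X"
    and "X \<in> free_semigroup_algebra \<Longrightarrow> Y \<in> free_semigroup_algebra \<Longrightarrow>
      \<Phi> (\<lambda>x. X x + Y x) = \<Phi> X + \<Phi> Y"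
    and "X \<in> free_semigroup_algebra \<Longrightarrow> Y \<in> free_semigroup_algebra \<Longrightarrow>
      \<Phi> (X \<circ> Y) = \<Phi> X ** \<Phi> Y"
  using assms by (simp_all add: unital_hom_def)

lemma unital_hom_eq_on_polynomials:
  assumes "unital_hom \<Phi>" "unital_hom \<Psi>" "\<And>i. \<Phi> (creation i) = \<Psi> (creation i)"
    and "X \<in> op_algebra (range creation)"
  shows "\<Phi> X = \<Psi> X"
  using assms(4)
proof induction
  case (op_gen X)
  then show ?case using assms(3) by auto
qed (use assms(1,2) in
    \<open>simp_all add: unital_hom_def polynomials_subset[THEN subsetD] o_def id_def\<close>)

text \<open>Two such homomorphisms agree on polynomials, which are WOT-dense, and continuous maps
  into a Hausdorff space are determined on a dense set.\<close>

lemma represents_unique: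
  assumes "represents A \<Phi>" "represents A \<Psi>"
  shows "\<Phi> = \<Psi>"
proof (rule extensionalityI)
  show "\<Phi> \<in> extensional free_semigroup_algebra" "\<Psi> \<in> extensional free_semigroup_algebra"
    by (rule representsD(1)[OF assms(1)], rule representsD(1)[OF assms(2)])
  fix X :: "'a list op"
  assume "X \<in> free_semigroup_algebra"
  then have "X \<in> subtopology wot free_semigroup_algebra closure_of op_algebra (range creation)"
    by (simp add: closure_of_subtopology Int_absorb1 polynomials_subset)
      (simp add: free_semigroup_algebra_def)
  then show "\<Phi> X = \<Psi> X"
  proof (rule forall_in_closure_of_eq)
    show "Hausdorff_space (euclidean :: (complex^'b^'b) topology)"
      by (rule Hausdorff_space_euclidean)
    show "\<Phi> Y = \<Psi> Y" if "Y \<in> op_algebra (range creation)" for Y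
      by (rule unital_hom_eq_on_polynomials[OF representsD(2)[OF assms(1)] representsD(2)[OF assms(2)] _ that])
        (simp add: representsD(4)[OF assms(1)] representsD(4)[OF assms(2)])
  qed (rule representsD(3)[OF assms(1)], rule representsD(3)[OF assms(2)])
qed

lemma Phi_eqI: "represents A \<Phi> \<Longrightarrow> Phi A = \<Phi>"
  unfolding Phi_def represents_def[symmetric]
  by (rule the_equality) (simp_all add: represents_unique)


section \<open>Existence for strict row contractions\<close>

definition word_prod :: "('n \<Rightarrow> complex^'d::finite^'d) \<Rightarrow> 'n list \<Rightarrow> complex^'d^'d" where
  "word_prod A w = foldr (\<lambda>i M. A i ** M) w (mat 1)"

lemma word_prod_simps [simp]:
  "word_prod A [] = mat 1" "word_prod A (i # w) = A i ** word_prod A w"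
  by (simp_all add: word_prod_def)

lemma cadjoint_mult: "cadjoint (M ** N) = cadjoint N ** cadjoint M"
  by (simp add: cadjoint_def matrix_matrix_mult_def vec_eq_iff mult.commute)

lemma cadjoint_one: "cadjoint (mat 1) = mat 1"
  by (simp add: cadjoint_def mat_def vec_eq_iff)

text \<open>Here \<open>inner\<close> is the real part of the Hermitian product, so both sides are
  the real part of one double sum.\<close>

lemma inner_cadjoint:
  fixes M :: "complex^'d::finite^'d"
  shows "inner (M *v x) y = inner x (cadjoint M *v y)"
proof -
  have "inner (M *v x) y = (\<Sum>i\<in>UNIV. \<Sum>j\<in>UNIV. Re (M$i$j * x$j * cnj (y$i)))"
    by (simp add: inner_vec_def matrix_vector_mult_def inner_complex_def sum_distrib_right
        sum_distrib_left sum.distrib algebra_simps sum_subtractf)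
  also have "\<dots> = (\<Sum>j\<in>UNIV. \<Sum>i\<in>UNIV. Re (M$i$j * x$j * cnj (y$i)))"
    by (rule sum.swap)
  also have "\<dots> = inner x (cadjoint M *v y)"
    by (simp add: inner_vec_def matrix_vector_mult_def inner_complex_def cadjoint_def
        sum_distrib_right sum_distrib_left sum.distrib algebra_simps sum_subtractf)
  finally show ?thesis .
qed

lemma sum_matrix_vector_mult: "(\<Sum>i\<in>I. M i) *v x = (\<Sum>i\<in>I. M i *v x)"
  by (induction I rule: infinite_finite_induct) (auto simp: matrix_vector_mult_add_rdistrib)

text \<open>The left side is the quadratic form at \<open>y\<close> of the sum of the A_i A_i^*,
  whose operator norm is the square of \<open>tuple_norm A\<close>.\<close>

lemma sum_norm_cadjoint_le:
  fixes A :: "'n::finite \<Rightarrow> complex^'d::finite^'d"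
  shows "(\<Sum>i\<in>UNIV. (norm (cadjoint (A i) *v y))\<^sup>2) \<le> (tuple_norm A)\<^sup>2 * (norm y)\<^sup>2"
proof -
  define P where "P = (\<Sum>i\<in>UNIV. A i ** cadjoint (A i))"
  have "(\<Sum>i\<in>UNIV. (norm (cadjoint (A i) *v y))\<^sup>2) = inner (P *v y) y"
    unfolding P_def sum_matrix_vector_mult inner_sum_left
    by (simp add: power2_norm_eq_inner inner_cadjoint flip: matrix_vector_mul_assoc)
  also have "\<dots> \<le> norm (P *v y) * norm y"
    by (rule norm_cauchy_schwarz)
  also have "\<dots> \<le> onorm ((*v) P) * norm y * norm y"
    by (intro mult_right_mono onorm) auto
  also have "onorm ((*v) P) = (tuple_norm A)\<^sup>2"
    by (simp add: tuple_norm_def P_def onorm_pos_le)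
  finally show ?thesis
    by (simp add: power2_eq_square mult.assoc)
qed

lemma words_length_le_Suc:
  "{w :: 'n list. length w \<le> Suc N}
    = insert [] (\<Union>i. (#) i ` {w. length w \<le> N})"
proof -
  have "w \<in> insert [] (\<Union>i. (#) i ` {w. length w \<le> N})" if "length w \<le> Suc N" for w :: "'n list"
    using that by (cases w) auto
  then show ?thesis by auto
qed

lemma finite_words_length_le: "finite {w :: 'n::finite list. length w \<le> N}"
  using finite_lists_length_le[of "UNIV :: 'n set" N] by simp

text \<open>Each further letter costs a factor r, the square of \<open>tuple_norm A\<close>, so
  words of length k contribute at most r^k times the squared norm of y, and the geometric series
  bounds the total. The induction strips the first letter and varies \<open>y\<close>, since
  A_{iw}^* y = A_w^* (A_i^* y).\<close>

lemma sum_norm_word_prod_le: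
  fixes A :: "'n::finite \<Rightarrow> complex^'d::finite^'d"
  assumes "tuple_norm A < 1"
  shows "(\<Sum>w | length w \<le> N. (norm (cadjoint (word_prod A w) *v y))\<^sup>2)
    \<le> (norm y)\<^sup>2 / (1 - (tuple_norm A)\<^sup>2)"
proof -
  define r where "r = (tuple_norm A)\<^sup>2"
  have "0 \<le> tuple_norm A"
    by (simp add: tuple_norm_def onorm_pos_le)
  then have r: "0 \<le> r" "r < 1"
    using assms by (auto simp: r_def power_less_one_iff)
  have "(\<Sum>w | length w \<le> N. (norm (cadjoint (word_prod A w) *v y))\<^sup>2) \<le> (norm y)\<^sup>2 / (1 - r)"
  proof (induction N arbitrary: y)
    case 0
    have "(norm y)\<^sup>2 * (1 - r) \<le> (norm y)\<^sup>2 * 1"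
      using r by (intro mult_left_mono) auto
    with r show ?case
      by (simp add: cadjoint_one field_simps)
  next
    case (Suc N)
    let ?f = "\<lambda>w y. (norm (cadjoint (word_prod A w) *v y))\<^sup>2"
    have "(\<Sum>w | length w \<le> Suc N. ?f w y)
        = ?f [] y + (\<Sum>w\<in>(\<Union>i. (#) i ` {w. length w \<le> N}). ?f w y)"
      unfolding words_length_le_Suc by (subst sum.insert) (auto simp: finite_words_length_le)
    also have "(\<Sum>w\<in>(\<Union>i. (#) i ` {w. length w \<le> N}). ?f w y)
        = (\<Sum>i\<in>UNIV. \<Sum>w\<in>(#) i ` {w. length w \<le> N}. ?f w y)"
      by (rule sum.UNION_disjoint) (auto simp: finite_words_length_le)
    also have "\<dots> = (\<Sum>i\<in>UNIV. \<Sum>w | length w \<le> N. ?f w (cadjoint (A i) *v y))"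
      by (simp add: sum.reindex cadjoint_mult matrix_vector_mul_assoc)
    also have "\<dots> \<le> (\<Sum>i\<in>UNIV. (norm (cadjoint (A i) *v y))\<^sup>2 / (1 - r))"
      by (intro sum_mono Suc.IH)
    also have "\<dots> \<le> r * (norm y)\<^sup>2 / (1 - r)"
      using sum_norm_cadjoint_le[of A y] r
      by (simp add: r_def divide_right_mono flip: sum_divide_distrib)
    \<comment> \<open>The empty word contributes 1 and the rest r / (1 - r), which add up to the
      same bound 1 / (1 - r).\<close>
    also have "?f [] y + r * (norm y)\<^sup>2 / (1 - r) = (norm y)\<^sup>2 / (1 - r)"
      using r by (simp add: cadjoint_one field_simps)
    finally show ?case by simp
  qed
  then show ?thesis by (simp add: r_def)
qed

lemma summable_word_prod:
  fixes A :: "'n::finite \<Rightarrow> complex^'d::finite^'d"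
  assumes "tuple_norm A < 1"
  shows "(\<lambda>w. (cmod (word_prod A w $ i $ j))\<^sup>2) summable_on UNIV"
proof (rule nonneg_bdd_above_summable_on)
  \<comment> \<open>Up to conjugation, the (i,j) entry of M is the j-th coordinate of M^* e_i, so
    the vector estimate controls single entries.\<close>
  have entry: "cmod (M $ i $ j) \<le> norm (cadjoint M *v axis i 1)" for M :: "complex^'d^'d"
  proof -
    have "(cadjoint M *v axis i 1) $ j = cnj (M $ i $ j)"
      by (simp add: cadjoint_def matrix_vector_mult_def axis_def if_distrib[of "\<lambda>x. _ * x"] cong: if_cong)
    then show ?thesis
      using Finite_Cartesian_Product.norm_nth_le[of "cadjoint M *v axis i 1" j] by simp
  qed
  show "bdd_above (sum (\<lambda>w. (cmod (word_prod A w $ i $ j))\<^sup>2) ` {F. F \<subseteq> UNIV \<and> finite F})"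
  proof (rule bdd_aboveI2)
    fix F :: "'n list set"
    assume "F \<in> {F. F \<subseteq> UNIV \<and> finite F}"
    then have "finite F" by simp
    \<comment> \<open>Inserting 0 keeps \<open>Max\<close> meaningful when \<open>F\<close> is
      empty.\<close>
    define N where "N = Max (insert 0 (length ` F))"
    have "F \<subseteq> {w. length w \<le> N}"
      using \<open>finite F\<close> by (auto simp: N_def)
    then have "(\<Sum>w\<in>F. (cmod (word_prod A w $ i $ j))\<^sup>2)
        \<le> (\<Sum>w | length w \<le> N. (norm (cadjoint (word_prod A w) *v axis i 1))\<^sup>2)"
      by (intro order_trans[OF sum_mono sum_mono2] power_mono entry)
        (auto simp: finite_words_length_le)
    also have "\<dots> \<le> (norm (axis i (1::complex) :: complex^'d))\<^sup>2 / (1 - (tuple_norm A)\<^sup>2)"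
      by (rule sum_norm_word_prod_le[OF assms])
    finally show "(\<Sum>w\<in>F. (cmod (word_prod A w $ i $ j))\<^sup>2)
        \<le> (norm (axis i (1::complex) :: complex^'d))\<^sup>2 / (1 - (tuple_norm A)\<^sup>2)" .
  qed
qed simp

text \<open>The conjugate cancels the one that \<open>cinner\<close> puts on its second argument.
  \<open>Abs_ell2\<close> is meaningful here once the entries are square summable, as for
  \<open>tuple_norm A < 1\<close>.\<close>

definition word_entries :: "('n \<Rightarrow> complex^'d::finite^'d) \<Rightarrow> 'd \<Rightarrow> 'd \<Rightarrow> 'n list ell2" where
  "word_entries A i j = Abs_ell2 (\<lambda>w. cnj (word_prod A w $ i $ j))"

text \<open>The map V, written through inner products so that each entry of
  \<open>word_sum A (X f)\<close> is a matrix coefficient of \<open>X\<close>, hence WOT-continuous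
  in \<open>X\<close>.\<close>

definition word_sum :: "('n \<Rightarrow> complex^'d::finite^'d) \<Rightarrow> 'n list ell2 \<Rightarrow> complex^'d^'d" where
  "word_sum A f = (\<chi> i j. cinner f (word_entries A i j))"

lemma Rep_word_entries:
  fixes A :: "'n::finite \<Rightarrow> complex^'d::finite^'d"
  assumes "tuple_norm A < 1"
  shows "Rep_ell2 (word_entries A i j) w = cnj (word_prod A w $ i $ j)"
  unfolding word_entries_def using summable_word_prod[OF assms] by (subst Abs_ell2_inverse) auto

lemma word_sum_add: "word_sum A (f + g) = word_sum A f + word_sum A g"
  by (simp add: word_sum_def vec_eq_iff cinner_add_left)

lemma word_sum_scale: "word_sum A (cscale c f) = mat c ** word_sum A f"
  by (simp add: vec_eq_iff mat_mult_nth) (simp add: word_sum_def cinner_scale_left)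

lemma word_sum_vacuum:
  fixes A :: "'n::finite \<Rightarrow> complex^'d::finite^'d"
  assumes "tuple_norm A < 1"
  shows "word_sum A (ket []) = mat 1"
  by (simp add: word_sum_def vec_eq_iff cinner_ket_left Rep_word_entries[OF assms] mat_def)

lemma has_sum_sum:
  fixes f :: "'i \<Rightarrow> 'a \<Rightarrow> 'b::topological_comm_monoid_add"
  assumes "\<And>i. i \<in> I \<Longrightarrow> (f i has_sum s i) A"
  shows "((\<lambda>x. \<Sum>i\<in>I. f i x) has_sum (\<Sum>i\<in>I. s i)) A"
  using assms
  by (induction I rule: infinite_finite_induct) (auto intro: has_sum_add)

text \<open>The adjoint of \<open>creation k\<close> shifts the coefficients from A_w to A_{kw} =
  A_k A_w, and the finite sum in the matrix product commutes with the infinite sum over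
  words.\<close>

lemma word_sum_creation:
  fixes A :: "'n::finite \<Rightarrow> complex^'d::finite^'d"
  assumes "tuple_norm A < 1"
  shows "word_sum A (creation k f) = A k ** word_sum A f"
proof -
  have "cinner f (annihilation k (word_entries A i j))
      = (\<Sum>l\<in>UNIV. A k $ i $ l * cinner f (word_entries A l j))" for i j
  proof -
    have "cinner f (annihilation k (word_entries A i j))
        = (\<Sum>\<^sub>\<infinity>w. \<Sum>l\<in>UNIV. A k $ i $ l * (Rep_ell2 f w * cnj (Rep_ell2 (word_entries A l j) w)))"
      unfolding cinner_def
      by (rule infsum_cong)
        (simp add: annihilation.rep_eq Rep_word_entries[OF assms] matrix_matrix_mult_def
          sum_distrib_left mult_ac)
    also have "\<dots> = (\<Sum>l\<in>UNIV. \<Sum>\<^sub>\<infinity>w. A k $ i $ l * (Rep_ell2 f w * cnj (Rep_ell2 (word_entries A l j) w)))"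
      by (intro infsumI has_sum_sum has_sum_infsum summable_on_cmult_right cinner_summable)
    finally show ?thesis
      by (simp add: infsum_cmult_right' cinner_def)
  qed
  then show ?thesis
    by (simp add: word_sum_def vec_eq_iff cinner_creation_left matrix_matrix_mult_def)
qed

lemma continuous_map_euclidean_matrix:
  fixes f :: "'a \<Rightarrow> complex^'d::finite^'e::finite"
  assumes "\<And>i j. continuous_map U euclidean (\<lambda>x. f x $ i $ j)"
  shows "continuous_map U euclidean f"
  unfolding continuous_map_atin limitin_canonical_iff
  using assms unfolding continuous_map_atin limitin_canonical_iff
  by (intro ballI vec_tendstoI) blast

lemma continuous_map_wot_word_sum: "continuous_map wot euclidean (\<lambda>X. word_sum A (X f))"
  by (rule continuous_map_euclidean_matrix) (simp add: word_sum_def continuous_map_wot_cinner)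

text \<open>With f = Y (ket []) this becomes the multiplicativity of the homomorphism built in
  \<open>represents_word_sum\<close>.\<close>

lemma word_sum_apply:
  fixes A :: "'n::finite \<Rightarrow> complex^'d::finite^'d"
  assumes A: "tuple_norm A < 1" and X: "X \<in> free_semigroup_algebra"
  shows "word_sum A (X f) = word_sum A (X (ket [])) ** word_sum A f"
proof (rule forall_in_closure_of_eq[OF X[unfolded free_semigroup_algebra_def]])
  show "Hausdorff_space (euclidean :: (complex^'d^'d) topology)"
    by (rule Hausdorff_space_euclidean)
  show "continuous_map wot euclidean (\<lambda>X. word_sum A (X f))"
    by (rule continuous_map_wot_word_sum)
  have "continuous_map euclidean euclidean (\<lambda>M :: complex^'d^'d. M ** word_sum A f)"
    using continuous_on_matrix_conj[of "mat 1" "word_sum A f"] by simp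
  from continuous_map_compose[OF continuous_map_wot_word_sum this]
  show "continuous_map wot euclidean (\<lambda>X. word_sum A (X (ket [])) ** word_sum A f)"
    by (simp add: o_def)
  fix X :: "'n list op"
  assume "X \<in> op_algebra (range creation)"
  then show "word_sum A (X f) = word_sum A (X (ket [])) ** word_sum A f"
  proof (induction arbitrary: f)
    case (op_gen X)
    then show ?case by (auto simp: word_sum_creation[OF A] word_sum_vacuum[OF A])
  next
    case op_one
    then show ?case by (simp add: word_sum_vacuum[OF A])
  next
    case (op_scale X c)
    show ?case
      by (simp add: word_sum_scale op_scale.IH[of f] flip: matrix_mul_assoc)
  next
    case (op_add X Y)
    show ?case
      by (simp add: word_sum_add op_add.IH[of f] matrix_add_rdistrib)
  next
    case (op_mult X Y)
    \<comment> \<open>With V = \<open>word_sum A\<close> and the vacuum xi, V(XYf) = V(X xi) V(Yf) =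
      V(X xi) V(Y xi) V(f), and V(X xi) V(Y xi) = V(XY xi). The hypothesis for \<open>X\<close> is
      thus used at two vectors, which is why \<open>f\<close> is generalised.\<close>
    show ?case
      using op_mult.IH(1)[of "Y f"] op_mult.IH(1)[of "Y (ket [])"] op_mult.IH(2)[of f]
      by (simp add: matrix_mul_assoc)
  qed
qed

lemma represents_word_sum:
  fixes A :: "'n::finite \<Rightarrow> complex^'d::finite^'d"
  assumes A: "tuple_norm A < 1"
  shows "represents A (restrict (\<lambda>X. word_sum A (X (ket []))) free_semigroup_algebra)"
proof -
  have "continuous_map (subtopology wot free_semigroup_algebra) euclidean
      (restrict (\<lambda>X. word_sum A (X (ket []))) free_semigroup_algebra)"
    by (rule continuous_map_eq[OF continuous_map_from_subtopology[OF continuous_map_wot_word_sum]])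
      auto
  moreover have "\<forall>X\<in>free_semigroup_algebra. \<forall>Y\<in>free_semigroup_algebra.
      word_sum A (X (Y (ket []))) = word_sum A (X (ket [])) ** word_sum A (Y (ket []))"
    by (intro ballI word_sum_apply[OF A])
  ultimately show ?thesis
    by (simp add: represents_def unital_hom_def fsa_scale fsa_add fsa_comp id_in_fsa
        creation_in_fsa word_sum_vacuum[OF A] word_sum_creation[OF A] word_sum_add word_sum_scale)
qed

lemma represents_Phi:
  fixes A :: "'n::finite \<Rightarrow> complex^'d::finite^'d"
  assumes "tuple_norm A < 1"
  shows "represents A (Phi A)"
  using represents_word_sum[OF assms] Phi_eqI by metis


section \<open>Similarity and kernels\<close>

lemma represents_conj:
  fixes T :: "complex^'d::finite^'d"
  assumes \<Phi>: "represents A \<Phi>" and ST: "S ** T = mat 1" and TS: "T ** S = mat 1"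
  shows "represents (\<lambda>i. T ** A i ** S) (restrict (\<lambda>X. T ** \<Phi> X ** S) free_semigroup_algebra)"
proof -
  have "continuous_map (subtopology wot free_semigroup_algebra) euclidean
      ((\<lambda>M. T ** M ** S) \<circ> \<Phi>)"
    by (rule continuous_map_compose[of _ euclidean])
      (simp_all add: representsD(3)[OF \<Phi>] continuous_on_matrix_conj)
  then have "continuous_map (subtopology wot free_semigroup_algebra) euclidean
      (restrict (\<lambda>X. T ** \<Phi> X ** S) free_semigroup_algebra)"
    by (rule continuous_map_eq) auto
  moreover have "T ** (M ** N) ** S = (T ** M ** S) ** (T ** N ** S)" for M N
    by (metis ST matrix_mul_assoc matrix_mul_rid)
  moreover have "T ** (mat c ** M) ** S = mat c ** (T ** M ** S)" for c M
  proof -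
    \<comment> \<open>Scalar matrices are central.\<close>
    have "T ** mat c = mat c ** T"
      by (simp add: vec_eq_iff mat_mult_nth)
        (simp add: matrix_matrix_mult_def mat_def if_distrib[of "\<lambda>x. _ * x"] mult.commute cong: if_cong)
    then show ?thesis by (simp add: matrix_mul_assoc)
  qed
  ultimately show ?thesis
    using representsD[OF \<Phi>] TS unital_homD[OF representsD(2)[OF \<Phi>]]
    by (simp add: represents_def unital_hom_def fsa_scale fsa_add fsa_comp id_in_fsa
        creation_in_fsa matrix_add_ldistrib matrix_add_rdistrib)
qed

lemma ker_Phi_similar:
  fixes A B :: "'n::finite \<Rightarrow> complex^'d::finite^'d"
  assumes "tuple_norm A < 1" and "similar_tuples A B"
  shows "ker_Phi A = ker_Phi B"
proof -
  obtain T where T: "invertible T" and B: "B = (\<lambda>i. T ** A i ** matrix_inv T)"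
    using assms(2) by (auto simp: similar_tuples_def)
  note inv = matrix_inv_left[OF T] matrix_inv_right[OF T]
  \<comment> \<open>The conjugate of \<open>Phi A\<close> meets the description of
    \<open>Phi B\<close>, so uniqueness identifies them.\<close>
  have "Phi B = restrict (\<lambda>X. T ** Phi A X ** matrix_inv T) free_semigroup_algebra"
    unfolding B by (intro Phi_eqI represents_conj represents_Phi assms(1) inv)
  moreover have "T ** M ** matrix_inv T = 0 \<longleftrightarrow> M = 0" for M
  proof
    assume "T ** M ** matrix_inv T = 0"
    then have "matrix_inv T ** (T ** M ** matrix_inv T) ** T = 0"
      by simp
    then show "M = 0"
      using inv by (metis matrix_mul_assoc matrix_mul_lid matrix_mul_rid)
  qed simp
  ultimately show ?thesis
    by (auto simp: ker_Phi_def)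
qed

text \<open>The image is a unital algebra containing every A_i, hence all of the matrix
  algebra.\<close>

lemma represents_surj:
  assumes \<Phi>: "represents A \<Phi>" and "irreducible_tuple A"
  shows "\<exists>X\<in>free_semigroup_algebra. \<Phi> X = M"
proof -
  have hom: "unital_hom \<Phi>" and gen: "\<And>i. \<Phi> (creation i) = A i"
    using representsD[OF \<Phi>] by simp_all
  have "M \<in> matrix_algebra (range A)"
    using assms(2) by (simp add: irreducible_tuple_def)
  then show ?thesis
  proof induction
    case (matrix_gen M)
    then obtain i where "\<Phi> (creation i) = M" using gen by auto
    then show ?case by (rule bexI[OF _ creation_in_fsa])
  next
    case matrix_one
    show ?case by (rule bexI[of _ id], rule unital_homD(1)[OF hom], rule id_in_fsa)
  next
    case (matrix_scale M c)
    from matrix_scale.IH obtain X where X: "X \<in> free_semigroup_algebra" "\<Phi> X = M" by (elim bexE)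
    then show ?case
      by (intro bexI[OF _ fsa_scale[OF X(1), of c]]) (simp add: unital_homD[OF hom])
  next
    case (matrix_add M N)
    from matrix_add.IH obtain X Y where X: "X \<in> free_semigroup_algebra" "\<Phi> X = M"
      and Y: "Y \<in> free_semigroup_algebra" "\<Phi> Y = N" by (elim bexE)
    then show ?case
      by (intro bexI[OF _ fsa_add[OF X(1) Y(1)]]) (simp add: unital_homD[OF hom])
  next
    case (matrix_mult M N)
    from matrix_mult.IH obtain X Y where X: "X \<in> free_semigroup_algebra" "\<Phi> X = M"
      and Y: "Y \<in> free_semigroup_algebra" "\<Phi> Y = N" by (elim bexE)
    show ?case
      by (rule bexI[OF _ fsa_comp[OF X(1) Y(1)]])
        (simp only: unital_homD(4)[OF hom X(1) Y(1)] X Y)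
  qed
qed

lemma unital_hom_diff:
  assumes "unital_hom \<Phi>" "X \<in> free_semigroup_algebra" "Y \<in> free_semigroup_algebra"
  shows "\<Phi> (\<lambda>x. X x - Y x) = \<Phi> X - \<Phi> Y"
proof -
  have "(\<lambda>x. X x - Y x) = (\<lambda>x. X x + cscale (- 1) (Y x))"
    by (simp add: cscale_minus_one)
  then have "\<Phi> (\<lambda>x. X x - Y x) = \<Phi> X + mat (- 1) ** \<Phi> Y"
    by (simp only: unital_homD[OF assms(1)] assms(2,3) fsa_scale)
  then show ?thesis
    by (simp add: vec_eq_iff mat_mult_nth)
qed

lemma similar_if_ker_eq:
  assumes \<Phi>: "represents A \<Phi>" and \<Psi>: "represents B \<Psi>" and irr: "irreducible_tuple A"
    and ker: "\<And>X. X \<in> free_semigroup_algebra \<Longrightarrow> \<Phi> X = 0 \<longleftrightarrow> \<Psi> X = 0"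
  shows "similar_tuples A B"
proof -
  have hom: "unital_hom \<Phi>" "unital_hom \<Psi>"
    and gen: "\<And>i. \<Phi> (creation i) = A i" "\<And>i. \<Psi> (creation i) = B i"
    using representsD[OF \<Phi>] representsD[OF \<Psi>] by simp_all
  \<comment> \<open>A mere set-theoretic section of \<open>\<Phi>\<close>; the algebraic properties
    of \<psi> come from \<open>eq\<close>, which makes the choice of preimage immaterial.\<close>
  define lift where "lift M = (SOME X. X \<in> free_semigroup_algebra \<and> \<Phi> X = M)" for M
  have lift: "lift M \<in> free_semigroup_algebra" "\<Phi> (lift M) = M" for M
    using someI_ex[of "\<lambda>X. X \<in> free_semigroup_algebra \<and> \<Phi> X = M"]
      represents_surj[OF \<Phi> irr, of M] unfolding lift_def by blast+
  \<comment> \<open>The difference of X and Y lies in the kernel of \<open>\<Phi>\<close>, hence in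
    that of \<open>\<Psi>\<close>.\<close>
  have eq: "\<Psi> X = \<Psi> Y"
    if "X \<in> free_semigroup_algebra" "Y \<in> free_semigroup_algebra" "\<Phi> X = \<Phi> Y" for X Y
    using ker[OF fsa_diff[OF that(1,2)]] that by (simp add: unital_hom_diff hom)
  define \<psi> where "\<psi> M = \<Psi> (lift M)" for M
  have \<psi>: "\<psi> (\<Phi> X) = \<Psi> X" if "X \<in> free_semigroup_algebra" for X
    unfolding \<psi>_def by (rule eq) (simp_all add: lift that)
  have "\<psi> (M + N) = \<psi> M + \<psi> N" for M N
    using \<psi>[OF fsa_add[OF lift(1)[of M] lift(1)[of N]]]
    by (simp add: unital_homD[OF hom(1)] unital_homD[OF hom(2)] lift \<psi>_def)
  moreover have "\<psi> (mat c ** M) = mat c ** \<psi> M" for c M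
    using \<psi>[OF fsa_scale[OF lift(1)[of M], of c]]
    by (simp add: unital_homD[OF hom(1)] unital_homD[OF hom(2)] lift \<psi>_def)
  moreover have "\<psi> (M ** N) = \<psi> M ** \<psi> N" for M N
    using \<psi>[OF fsa_comp[OF lift(1)[of M] lift(1)[of N]]]
    by (simp only: unital_homD(4)[OF hom(1)] unital_homD(4)[OF hom(2)] lift \<psi>_def)
  \<comment> \<open>Injectivity uses the other inclusion of kernels.\<close>
  moreover have "M = 0" if "\<psi> M = 0" for M
    using that ker[OF lift(1)[of M]] lift(2)[of M] by (simp add: \<psi>_def)
  ultimately obtain T where "invertible T" "\<And>M. \<psi> M = T ** M ** matrix_inv T"
    using matrix_endomorphism_inner[of \<psi>] by blast
  \<comment> \<open>Evaluating at the generators gives B_i = \<psi>(A_i), the conjugate of A_i by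
    T.\<close>
  then show ?thesis
    using \<psi>[OF creation_in_fsa] gen unfolding similar_tuples_def by metis
qed

theorem corollary7p7:
  fixes A B :: "'n::finite \<Rightarrow> complex^'d::finite^'d"
  assumes "CARD('n) \<ge> 2"
    and "irreducible_tuple A" and "irreducible_tuple B"
    and "tuple_norm A < 1" and "tuple_norm B < 1"
  shows "similar_tuples A B \<longleftrightarrow> ker_Phi A = ker_Phi B"
proof
  assume "similar_tuples A B"
  then show "ker_Phi A = ker_Phi B"
    by (rule ker_Phi_similar[OF assms(4)])
next
  assume "ker_Phi A = ker_Phi B"
  then have "Phi A X = 0 \<longleftrightarrow> Phi B X = 0" if "X \<in> free_semigroup_algebra" for X
    using that unfolding ker_Phi_def by blast
  then show "similar_tuples A B"
    by (rule similar_if_ker_eq[OF represents_Phi[OF assms(4)] represents_Phi[OF assms(5)] assms(2)])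
qed

end
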